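(* Let $A$ be a 4-dimensional complex 3-Lie algebra with basis $\{e_1,e_2,e_3,e_4\}$ whose non-zero brackets of basis elements (up to skew-symmetry) are given by one of the following: Case (2): $[e_1,e_2,e_3]=e_1$; Case (5): $[e_2,e_3,e_4]=e_2,\ [e_1,e_3,e_4]=e_1$; Case (6): $[e_2,e_3,e_4]=\alpha e_1+e_2,\ [e_1,e_3,e_4]=e_2$, where $\alpha\in\mathbb{C}$, $\alpha\neq0$. Then any double construction 3-Lie bialgebra $(A,\Delta)$ is trivial, i.e. $\Delta=0$.
   Context: A 3-Lie algebra is a vector space $A$ with a trilinear, totally skew-symmetric bracket $[\cdot,\cdot,\cdot]:\otimes^3A\to A$ such that for all $x_1,\dots,x_5\in A$: $[x_1,x_2,[x_3,x_4,x_5]]=[[x_1,x_2,x_3],x_4,x_5]+[x_3,[x_1,x_2,x_4],x_5]+[x_3,x_4,[x_1,x_2,x_5]]$. Put $\mathrm{ad}_{x,y}z=[x,y,z]$. A double construction 3-Lie bialgebra is a pair $(A,\Delta)$ of a 3-Lie algebra $A$ and a linear map $\Delta:A\to A\otimes A\otimes A$ such that the dual map $\Delta^*:A^*\otimes A^*\otimes A^*\to A^*$ defines a 3-Lie algebra structure on $A^*$ and for all $x,y,z\in A$: $\Delta([x,y,z])=(\mathrm{id}\otimes\mathrm{id}\otimes\mathrm{ad}_{y,z})\Delta(x)+(\mathrm{id}\otimes\mathrm{id}\otimes\mathrm{ad}_{z,x})\Delta(y)+(\mathrm{id}\otimes\mathrm{id}\otimes\mathrm{ad}_{x,y})\Delta(z)$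 and $\Delta([x,y,z])=(\mathrm{id}\otimes\mathrm{id}\otimes\mathrm{ad}_{y,z})\Delta(x)+(\mathrm{id}\otimes\mathrm{ad}_{y,z}\otimes\mathrm{id})\Delta(x)+(\mathrm{ad}_{y,z}\otimes\mathrm{id}\otimes\mathrm{id})\Delta(x)$. *)

theory Defs
  imports Complex_Main "HOL-Library.Poly_Mapping"
begin

section \<open>Complex vector spaces\<close>

class complex_vector = ab_group_add +
  fixes scaleC :: "complex \<Rightarrow> 'a \<Rightarrow> 'a"  (infixr "*\<^sub>C" 75)
  assumes scaleC_add_right: "c *\<^sub>C (x + y) = c *\<^sub>C x + c *\<^sub>C y"
    and scaleC_add_left: "(c + d) *\<^sub>C x = c *\<^sub>C x + d *\<^sub>C x"
    and scaleC_scaleC: "c *\<^sub>C d *\<^sub>C x = (c * d) *\<^sub>C x"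
    and scaleC_one: "1 *\<^sub>C x = x"

global_interpretation complex_vector:
    vector_space "scaleC :: complex \<Rightarrow> 'a \<Rightarrow> 'a::complex_vector"
  by unfold_locales
    (simp_all add: scaleC_add_right scaleC_add_left scaleC_scaleC scaleC_one)

abbreviation clinear :: "('a::complex_vector \<Rightarrow> 'b::complex_vector) \<Rightarrow> bool"
  where "clinear \<equiv> Vector_Spaces.linear scaleC scaleC"

lemma clinear_iff:
  "clinear f \<longleftrightarrow> (\<forall>x y. f (x + y) = f x + f y) \<and> (\<forall>c x. f (c *\<^sub>C x) = c *\<^sub>C f x)"
  by (auto simp: Vector_Spaces.linear_iff complex_vector.vector_space_axioms)

lemma clinear_add: "clinear f \<Longrightarrow> f (x + y) = f x + f y"
  and clinear_scale: "clinear f \<Longrightarrow> f (c *\<^sub>C x) = c *\<^sub>C f x"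
  by (simp_all add: clinear_iff)

lemma clinear_0: "clinear f \<Longrightarrow> f 0 = 0"
  using clinear_add[of f 0 0] by simp

lemma clinear_diff: "clinear f \<Longrightarrow> f (x - y) = f x - f y"
  using clinear_add[of f "x - y" y] by (simp add: algebra_simps)

lemma clinear_sum: "clinear f \<Longrightarrow> f (sum g K) = (\<Sum>k\<in>K. f (g k))"
  by (induction K rule: infinite_finite_induct) (auto simp: clinear_0 clinear_add)

definition trilinear ::
    "('a::complex_vector \<Rightarrow> 'a \<Rightarrow> 'a \<Rightarrow> 'b::complex_vector) \<Rightarrow> bool"
  where "trilinear f \<longleftrightarrow>
    (\<forall>y z. clinear (\<lambda>x. f x y z)) \<and>
    (\<forall>x z. clinear (\<lambda>y. f x y z)) \<and>
    (\<forall>x y. clinear (\<lambda>z. f x y z))"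

instantiation complex :: complex_vector
begin
definition scaleC_complex_def: "c *\<^sub>C (z::complex) = c * z"
instance by standard (simp_all add: scaleC_complex_def algebra_simps)
end

instantiation poly_mapping :: (type, complex_vector) complex_vector
begin

lift_definition scaleC_poly_mapping :: "complex \<Rightarrow> ('a \<Rightarrow>\<^sub>0 'b) \<Rightarrow> ('a \<Rightarrow>\<^sub>0 'b)"
  is "\<lambda>c f k. c *\<^sub>C f k"
  by (erule finite_subset[rotated]) auto

instance
  by standard (transfer; simp add: fun_eq_iff scaleC_add_right scaleC_add_left scaleC_scaleC
      scaleC_one)+

end


section \<open>The dual space\<close>

typedef (overloaded) 'a dual = "{f :: 'a::complex_vector \<Rightarrow> complex. clinear f}"
  morphisms dual_apply Abs_dual
  by (rule exI[of _ "\<lambda>_. 0"]) (simp add: clinear_iff)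

setup_lifting type_definition_dual

instantiation dual :: (complex_vector) complex_vector
begin

lift_definition zero_dual :: "'a dual" is "\<lambda>_. 0"
  by (simp add: clinear_iff)
lift_definition plus_dual :: "'a dual \<Rightarrow> 'a dual \<Rightarrow> 'a dual" is "\<lambda>f g x. f x + g x"
  by (simp add: clinear_iff scaleC_add_right)
lift_definition uminus_dual :: "'a dual \<Rightarrow> 'a dual" is "\<lambda>f x. - f x"
  by (simp add: clinear_iff)
lift_definition minus_dual :: "'a dual \<Rightarrow> 'a dual \<Rightarrow> 'a dual" is "\<lambda>f g x. f x - g x"
  by (simp add: clinear_iff complex_vector.scale_right_diff_distrib)
lift_definition scaleC_dual :: "complex \<Rightarrow> 'a dual \<Rightarrow> 'a dual" is "\<lambda>c f x. c *\<^sub>C f x"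
  by (simp add: clinear_iff scaleC_add_right scaleC_scaleC mult.commute)

instance
  by standard (transfer; simp add: fun_eq_iff scaleC_add_right scaleC_add_left scaleC_scaleC
      scaleC_one)+

end


section \<open>The tensor cube\<close>

text \<open>
  The tensor cube of a space is the free vector space on triples of vectors modulo
  the subspace spanned by the trilinearity relations.
\<close>

abbreviation free_triple :: "'a \<Rightarrow> 'a \<Rightarrow> 'a \<Rightarrow> (('a \<times> 'a \<times> 'a) \<Rightarrow>\<^sub>0 complex)"
  where "free_triple x y z \<equiv> Poly_Mapping.single (x, y, z) 1"

inductive_set trilinearity_relators ::
    "(('a::complex_vector \<times> 'a \<times> 'a) \<Rightarrow>\<^sub>0 complex) set"
  where
    add1: "free_triple (x + x') y z - (free_triple x y z + free_triple x' y z)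
      \<in> trilinearity_relators"
  | add2: "free_triple x (y + y') z - (free_triple x y z + free_triple x y' z)
      \<in> trilinearity_relators"
  | add3: "free_triple x y (z + z') - (free_triple x y z + free_triple x y z')
      \<in> trilinearity_relators"
  | scale1: "free_triple (c *\<^sub>C x) y z - c *\<^sub>C free_triple x y z \<in> trilinearity_relators"
  | scale2: "free_triple x (c *\<^sub>C y) z - c *\<^sub>C free_triple x y z \<in> trilinearity_relators"
  | scale3: "free_triple x y (c *\<^sub>C z) - c *\<^sub>C free_triple x y z \<in> trilinearity_relators"

definition tensor3_relations ::
    "(('a::complex_vector \<times> 'a \<times> 'a) \<Rightarrow>\<^sub>0 complex) set"
  where "tensor3_relations = complex_vector.span trilinearity_relators"

lemma subspace_tensor3_relations: "complex_vector.subspace tensor3_relations"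
  unfolding tensor3_relations_def by (rule complex_vector.subspace_span)

quotient_type (overloaded) 'a tensor3 =
    "('a::complex_vector \<times> 'a \<times> 'a) \<Rightarrow>\<^sub>0 complex" /
    "\<lambda>s t. s - t \<in> tensor3_relations"
proof (rule equivpI)
  let ?R = "\<lambda>s t. s - t \<in> (tensor3_relations :: (('a \<times> 'a \<times> 'a) \<Rightarrow>\<^sub>0 complex) set)"
  note sub = subspace_tensor3_relations
  show "reflp ?R"
    using complex_vector.subspace_0[OF sub] by (auto intro: reflpI)
  show "symp ?R"
  proof (rule sympI)
    show "?R t s" if "?R s t" for s t
      using complex_vector.subspace_neg[OF sub that] by simp
  qed
  show "transp ?R"
  proof (rule transpI)
    show "?R s u" if "?R s t" "?R t u" for s t u
      using complex_vector.subspace_add[OF sub that] by simp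
  qed
qed

lemma tensor3_abs_cases:
  obtains s where "t = abs_tensor3 s"
  using Quotient3_abs_rep[OF Quotient3_tensor3] by metis

instantiation tensor3 :: (complex_vector) complex_vector
begin

lift_definition zero_tensor3 :: "'a tensor3" is "0" .
lift_definition plus_tensor3 :: "'a tensor3 \<Rightarrow> 'a tensor3 \<Rightarrow> 'a tensor3" is "(+)"
  by (drule (1) complex_vector.subspace_add[OF subspace_tensor3_relations])
    (simp add: algebra_simps)
lift_definition uminus_tensor3 :: "'a tensor3 \<Rightarrow> 'a tensor3" is "uminus"
  by (drule complex_vector.subspace_neg[OF subspace_tensor3_relations]) simp
lift_definition minus_tensor3 :: "'a tensor3 \<Rightarrow> 'a tensor3 \<Rightarrow> 'a tensor3" is "(-)"
  by (drule (1) complex_vector.subspace_diff[OF subspace_tensor3_relations])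
    (simp add: algebra_simps)
lift_definition scaleC_tensor3 :: "complex \<Rightarrow> 'a tensor3 \<Rightarrow> 'a tensor3" is "scaleC"
  by (simp add: complex_vector.subspace_scale[OF subspace_tensor3_relations]
      flip: complex_vector.scale_right_diff_distrib)

instance
  by standard (transfer; simp add: scaleC_add_right scaleC_add_left scaleC_scaleC
      scaleC_one complex_vector.subspace_0[OF subspace_tensor3_relations])+

end

lift_definition tensor3 :: "'a::complex_vector \<Rightarrow> 'a \<Rightarrow> 'a \<Rightarrow> 'a tensor3"
  is free_triple .

lemma tensor3_eqI: "s - t \<in> trilinearity_relators \<Longrightarrow> abs_tensor3 s = abs_tensor3 t"
  by (simp add: tensor3.abs_eq_iff tensor3_relations_def complex_vector.span_base)

lemma trilinear_tensor3: "trilinear tensor3"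
  unfolding trilinear_def clinear_iff tensor3.abs_eq plus_tensor3.abs_eq scaleC_tensor3.abs_eq
  by (intro conjI allI; rule tensor3_eqI; rule trilinearity_relators.intros)

text \<open>The linear map on the tensor cube induced by a trilinear map (unspecified for other maps).\<close>

definition tensor3_lift ::
    "('a::complex_vector \<Rightarrow> 'a \<Rightarrow> 'a \<Rightarrow> 'b::complex_vector) \<Rightarrow> 'a tensor3 \<Rightarrow> 'b"
  where "tensor3_lift f = (THE g. clinear g \<and> (\<forall>x y z. g (tensor3 x y z) = f x y z))"

definition free_extend :: "('k \<Rightarrow> 'b) \<Rightarrow> ('k \<Rightarrow>\<^sub>0 complex) \<Rightarrow> 'b::complex_vector"
  where "free_extend f s = (\<Sum>k\<in>Poly_Mapping.keys s. Poly_Mapping.lookup s k *\<^sub>C f k)"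

lemma free_extend_superset:
  assumes "finite K" "Poly_Mapping.keys s \<subseteq> K"
  shows "free_extend f s = (\<Sum>k\<in>K. Poly_Mapping.lookup s k *\<^sub>C f k)"
  unfolding free_extend_def using assms
  by (intro sum.mono_neutral_left) (auto simp: in_keys_iff)

lemma lookup_scaleC: "Poly_Mapping.lookup (c *\<^sub>C s) k = c *\<^sub>C Poly_Mapping.lookup s k"
  by transfer simp

lemma clinear_free_extend: "clinear (free_extend f)"
  unfolding clinear_iff
proof (intro conjI allI)
  fix s t :: "'a \<Rightarrow>\<^sub>0 complex"
  let ?K = "Poly_Mapping.keys s \<union> Poly_Mapping.keys t"
  have "free_extend f (s + t) = (\<Sum>k\<in>?K. Poly_Mapping.lookup (s + t) k *\<^sub>C f k)"
    by (rule free_extend_superset) (use Poly_Mapping.keys_add[of s t] in auto)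
  also have "\<dots> = free_extend f s + free_extend f t"
    by (simp add: lookup_add scaleC_add_left sum.distrib
        free_extend_superset[of ?K s] free_extend_superset[of ?K t])
  finally show "free_extend f (s + t) = free_extend f s + free_extend f t" .
next
  fix c and s :: "'a \<Rightarrow>\<^sub>0 complex"
  have "free_extend f (c *\<^sub>C s)
      = (\<Sum>k\<in>Poly_Mapping.keys s. Poly_Mapping.lookup (c *\<^sub>C s) k *\<^sub>C f k)"
    by (rule free_extend_superset) (auto simp: in_keys_iff lookup_scaleC scaleC_complex_def)
  also have "\<dots> = c *\<^sub>C free_extend f s"
    by (simp add: free_extend_def lookup_scaleC scaleC_complex_def scaleC_scaleC
        complex_vector.scale_sum_right)
  finally show "free_extend f (c *\<^sub>C s) = c *\<^sub>C free_extend f s" .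
qed

lemma free_extend_single: "free_extend f (Poly_Mapping.single k 1) = f k"
  by (simp add: free_extend_def scaleC_one)

lemma free_extend_ident:
  "free_extend (\<lambda>k. Poly_Mapping.single k 1) s = s"
proof (rule poly_mapping_eqI)
  fix k
  have *: "Poly_Mapping.lookup (sum g K) k = (\<Sum>j\<in>K. Poly_Mapping.lookup (g j) k)"
    if "finite K" for g :: "'a \<Rightarrow> ('a \<Rightarrow>\<^sub>0 complex)" and K
    using that by (induction K) (auto simp: lookup_add)
  show "Poly_Mapping.lookup (free_extend (\<lambda>k. Poly_Mapping.single k 1) s) k
      = Poly_Mapping.lookup s k"
    by (simp add: free_extend_def * lookup_scaleC lookup_single when_def scaleC_complex_def
        if_distrib in_keys_iff cong: if_cong)
qed

lemma tensor3_universal: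
  fixes f :: "'a::complex_vector \<Rightarrow> 'a \<Rightarrow> 'a \<Rightarrow> 'b::complex_vector"
  assumes f: "trilinear f"
  shows "\<exists>!g. clinear g \<and> (\<forall>x y z. g (tensor3 x y z) = f x y z)"
proof (rule ex_ex1I)
  define F where "F = free_extend (\<lambda>(x, y, z). f x y z)"
  have lin: "clinear F" unfolding F_def by (rule clinear_free_extend)
  have F1: "F (free_triple x y z) = f x y z" for x y z
    by (simp add: F_def free_extend_single)
  have F0: "F s = 0" if "s \<in> tensor3_relations" for s
    using that unfolding tensor3_relations_def
  proof (induction rule: complex_vector.span_induct)
    case base
    show ?case
      by (rule complex_vector.subspaceI)
        (use lin clinear_0[OF lin] in \<open>auto simp: clinear_iff\<close>)
  next
    case (step s)
    then show ?case
      by (cases rule: trilinearity_relators.cases)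
        (use f in \<open>auto simp: clinear_diff[OF lin] clinear_add[OF lin] clinear_scale[OF lin] F1
           trilinear_def clinear_iff\<close>)
  qed
  define G where "G t = F (rep_tensor3 t)" for t
  have G: "G (abs_tensor3 s) = F s" for s
  proof -
    have "rep_tensor3 (abs_tensor3 s) - s \<in> tensor3_relations"
      using Quotient3_tensor3 by (rule rep_abs_rsp_left)
        (simp add: complex_vector.subspace_0[OF subspace_tensor3_relations])
    then have "F (rep_tensor3 (abs_tensor3 s) - s) = 0" by (rule F0)
    then show ?thesis by (simp add: G_def clinear_diff[OF lin])
  qed
  have "G (s + t) = G s + G t" for s t
    by (cases s rule: tensor3_abs_cases; cases t rule: tensor3_abs_cases) (use lin in \<open>simp add: plus_tensor3.abs_eq G clinear_iff\<close>)
  moreover have "G (c *\<^sub>C s) = c *\<^sub>C G s" for c s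
    by (cases s rule: tensor3_abs_cases) (use lin in \<open>simp add: scaleC_tensor3.abs_eq G clinear_iff\<close>)
  moreover have "G (tensor3 x y z) = f x y z" for x y z
    by (simp add: tensor3.abs_eq G F1)
  ultimately show "\<exists>g. clinear g \<and> (\<forall>x y z. g (tensor3 x y z) = f x y z)"
    by (auto simp: clinear_iff)
next
  fix g h
  assume g: "clinear g \<and> (\<forall>x y z. g (tensor3 x y z) = f x y z)"
    and h: "clinear h \<and> (\<forall>x y z. h (tensor3 x y z) = f x y z)"
  have abs: "clinear (abs_tensor3 :: _ \<Rightarrow> 'a tensor3)"
    by (simp add: clinear_iff plus_tensor3.abs_eq scaleC_tensor3.abs_eq)
  show "g = h"
  proof
    fix t :: "'a tensor3"
    obtain s where t: "t = abs_tensor3 s" by (rule tensor3_abs_cases)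
    have "k (abs_tensor3 s)
        = (\<Sum>j\<in>Poly_Mapping.keys s. Poly_Mapping.lookup s j *\<^sub>C (case j of (x, y, z) \<Rightarrow> f x y z))"
      if k: "clinear k \<and> (\<forall>x y z. k (tensor3 x y z) = f x y z)" for k
    proof -
      have "k (abs_tensor3 s) = k (abs_tensor3 (free_extend (\<lambda>k. Poly_Mapping.single k 1) s))"
        by (simp add: free_extend_ident)
      also have "\<dots> = (\<Sum>j\<in>Poly_Mapping.keys s.
          k (Poly_Mapping.lookup s j *\<^sub>C abs_tensor3 (Poly_Mapping.single j 1)))"
        using k unfolding free_extend_def
        by (simp add: clinear_sum[OF abs] clinear_sum[of k] scaleC_tensor3.abs_eq)
      also have "\<dots> = (\<Sum>j\<in>Poly_Mapping.keys s.
          Poly_Mapping.lookup s j *\<^sub>C (case j of (x, y, z) \<Rightarrow> f x y z))"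
        using k by (intro sum.cong refl) (auto simp: clinear_iff tensor3.abs_eq[symmetric])
      finally show ?thesis .
    qed
    from this[OF g] this[OF h] show "g t = h t" by (simp add: t)
  qed
qed

lemma
  assumes "trilinear f"
  shows clinear_tensor3_lift: "clinear (tensor3_lift f)"
    and tensor3_lift_tensor3: "tensor3_lift f (tensor3 x y z) = f x y z"
  using theI'[OF tensor3_universal[OF assms]] unfolding tensor3_lift_def by auto

definition tensor3_map ::
    "('a::complex_vector \<Rightarrow> 'a) \<Rightarrow> ('a \<Rightarrow> 'a) \<Rightarrow> ('a \<Rightarrow> 'a) \<Rightarrow> 'a tensor3 \<Rightarrow> 'a tensor3"
  where "tensor3_map f g h = tensor3_lift (\<lambda>x y z. tensor3 (f x) (g y) (h z))"

lemma
  assumes "clinear f" "clinear g" "clinear h"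
  shows clinear_tensor3_map: "clinear (tensor3_map f g h)"
    and tensor3_map_tensor3: "tensor3_map f g h (tensor3 x y z) = tensor3 (f x) (g y) (h z)"
proof -
  have "trilinear (\<lambda>x y z. tensor3 (f x) (g y) (h z))"
    using assms trilinear_tensor3[where 'a = 'a] unfolding trilinear_def clinear_iff by simp
  then show "clinear (tensor3_map f g h)"
    "tensor3_map f g h (tensor3 x y z) = tensor3 (f x) (g y) (h z)"
    unfolding tensor3_map_def by (rule clinear_tensor3_lift tensor3_lift_tensor3)+
qed

text \<open>
  The canonical pairing of the tensor cube of the dual space with the tensor cube of
  the space itself: a pure tensor of functionals acts factorwise on pure tensors.
\<close>

definition tensor3_pairing :: "'a::complex_vector dual tensor3 \<Rightarrow> 'a tensor3 \<Rightarrow> complex"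
  where "tensor3_pairing \<xi> t =
    tensor3_lift (\<lambda>a b c.
      tensor3_lift (\<lambda>x y z. dual_apply a x * dual_apply b y * dual_apply c z) t) \<xi>"

lemma clinear_dual_apply: "clinear (dual_apply a)"
  using dual_apply[of a] by simp

lemma trilinear_dual_product:
  "trilinear (\<lambda>x y z. dual_apply a x * dual_apply b y * dual_apply c z)"
  using clinear_dual_apply[of a] clinear_dual_apply[of b] clinear_dual_apply[of c]
  unfolding trilinear_def clinear_iff by (simp add: scaleC_complex_def algebra_simps)

lemma tensor3_induct [case_names add scale tensor]:
  assumes add: "\<And>s t. P s \<Longrightarrow> P t \<Longrightarrow> P (s + t)"
    and scale: "\<And>c s. P s \<Longrightarrow> P (c *\<^sub>C s)"
    and tensor: "\<And>x y z. P (tensor3 x y z)"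
  shows "P t"
proof -
  obtain s where t: "t = abs_tensor3 s" by (rule tensor3_abs_cases)
  have abs: "clinear (abs_tensor3 :: _ \<Rightarrow> 'a tensor3)"
    by (simp add: clinear_iff plus_tensor3.abs_eq scaleC_tensor3.abs_eq)
  have P0: "P 0" using scale[OF tensor, of 0] by simp
  have sum: "P (sum g K)" if "\<And>k. P (g k)" for K and g :: "('a \<times> 'a \<times> 'a) \<Rightarrow> 'a tensor3"
    by (induction K rule: infinite_finite_induct) (auto simp: P0 that add)
  have "P (abs_tensor3 (free_extend (\<lambda>k. Poly_Mapping.single k 1) s))"
    unfolding free_extend_def clinear_sum[OF abs] scaleC_tensor3.abs_eq[symmetric]
    by (rule sum, rule scale) (auto simp: tensor3.abs_eq[symmetric] intro: tensor)
  then show ?thesis by (simp add: free_extend_ident t)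
qed

lemma trilinear_pairing_aux:
  "trilinear (\<lambda>a b c.
     tensor3_lift (\<lambda>x y z. dual_apply a x * dual_apply b y * dual_apply c z) t)"
proof (induction t rule: tensor3_induct)
  case (add s t)
  then show ?case
    unfolding trilinear_def clinear_iff clinear_add[OF clinear_tensor3_lift[OF trilinear_dual_product]]
    by (simp add: scaleC_add_right add.assoc add.left_commute)
next
  case (scale c s)
  then show ?case
    unfolding trilinear_def clinear_iff clinear_scale[OF clinear_tensor3_lift[OF trilinear_dual_product]]
    by (simp add: scaleC_add_right scaleC_scaleC mult.commute[of c])
next
  case (tensor x y z)
  show ?case
    unfolding tensor3_lift_tensor3[OF trilinear_dual_product] trilinear_def clinear_iff
    by (simp add: plus_dual.rep_eq scaleC_dual.rep_eq scaleC_complex_def algebra_simps)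
qed

lemma clinear_tensor3_pairing_left: "clinear (\<lambda>\<xi>. tensor3_pairing \<xi> t)"
  unfolding tensor3_pairing_def by (rule clinear_tensor3_lift[OF trilinear_pairing_aux])

lemma tensor3_pairing_tensor3_left:
  "tensor3_pairing (tensor3 a b c) t =
   tensor3_lift (\<lambda>x y z. dual_apply a x * dual_apply b y * dual_apply c z) t"
  unfolding tensor3_pairing_def by (rule tensor3_lift_tensor3[OF trilinear_pairing_aux])

lemma tensor3_pairing_tensor3:
  "tensor3_pairing (tensor3 a b c) (tensor3 x y z) =
   dual_apply a x * dual_apply b y * dual_apply c z"
  unfolding tensor3_pairing_tensor3_left by (rule tensor3_lift_tensor3[OF trilinear_dual_product])

lemma clinear_tensor3_pairing_right: "clinear (tensor3_pairing \<xi>)"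
proof (induction \<xi> rule: tensor3_induct)
  case (add s t)
  then show ?case
    unfolding clinear_iff clinear_add[OF clinear_tensor3_pairing_left]
    by (simp add: scaleC_add_right add.assoc add.left_commute)
next
  case (scale c s)
  then show ?case
    unfolding clinear_iff clinear_scale[OF clinear_tensor3_pairing_left]
    by (simp add: scaleC_add_right scaleC_scaleC mult.commute[of c])
next
  case (tensor a b c)
  show ?case
    unfolding tensor3_pairing_tensor3_left
    by (rule clinear_tensor3_lift[OF trilinear_dual_product])
qed


section \<open>3-Lie algebras and double construction 3-Lie bialgebras\<close>

definition three_lie_algebra ::
    "('a::complex_vector \<Rightarrow> 'a \<Rightarrow> 'a \<Rightarrow> 'a) \<Rightarrow> bool"
  where "three_lie_algebra br \<longleftrightarrow>
    trilinear br \<and>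
    (\<forall>x y z. br y x z = - br x y z) \<and>
    (\<forall>x y z. br x z y = - br x y z) \<and>
    (\<forall>x1 x2 x3 x4 x5.
       br x1 x2 (br x3 x4 x5) =
       br (br x1 x2 x3) x4 x5 + br x3 (br x1 x2 x4) x5 + br x3 x4 (br x1 x2 x5))"

text \<open>
  The transpose of a cobracket, restricted along the canonical map from the tensor cube
  of the dual to the dual of the tensor cube (meaningful for linear cobrackets only).
\<close>

definition dual_map ::
    "('a::complex_vector \<Rightarrow> 'a tensor3) \<Rightarrow> 'a dual tensor3 \<Rightarrow> 'a dual"
  where "dual_map \<Delta> \<xi> = Abs_dual (\<lambda>x. tensor3_pairing \<xi> (\<Delta> x))"

lemma dual_apply_dual_map:
  assumes "clinear \<Delta>"
  shows "dual_apply (dual_map \<Delta> \<xi>) x = tensor3_pairing \<xi> (\<Delta> x)"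
proof -
  have "clinear (\<lambda>x. tensor3_pairing \<xi> (\<Delta> x))"
    using assms clinear_tensor3_pairing_right[of \<xi>] unfolding clinear_iff by simp
  then show ?thesis by (simp add: dual_map_def Abs_dual_inverse)
qed

definition double_construction_3lie_bialgebra ::
    "('a::complex_vector \<Rightarrow> 'a \<Rightarrow> 'a \<Rightarrow> 'a) \<Rightarrow> ('a \<Rightarrow> 'a tensor3) \<Rightarrow> bool"
  where "double_construction_3lie_bialgebra br \<Delta> \<longleftrightarrow>
    three_lie_algebra br \<and>
    clinear \<Delta> \<and>
    three_lie_algebra (\<lambda>a b c. dual_map \<Delta> (tensor3 a b c)) \<and>
    (\<forall>x y z. \<Delta> (br x y z) =
       tensor3_map id id (br y z) (\<Delta> x) +
       tensor3_map id id (br z x) (\<Delta> y) +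
       tensor3_map id id (br x y) (\<Delta> z)) \<and>
    (\<forall>x y z. \<Delta> (br x y z) =
       tensor3_map id id (br y z) (\<Delta> x) +
       tensor3_map id (br y z) id (\<Delta> x) +
       tensor3_map (br y z) id id (\<Delta> x))"

end

theory Submission
  imports Defs
begin

text \<open>
  After relabelling the basis, all three algebras have \<open>[v, e\<^sub>3, e\<^sub>4] = T v\<close> on
  \<open>V = \<langle>e\<^sub>1, e\<^sub>2\<rangle>\<close> and \<open>[e\<^sub>1, e\<^sub>2, \<cdot>] = 0\<close>, where \<open>T\<close> is an endomorphism of \<open>V\<close> of nonzero trace.
  As \<open>\<Delta>\<close> takes skew-symmetric values, \<open>\<Delta> x = e\<^sub>1 \<and> e\<^sub>2 \<and> w x + u x \<and> e\<^sub>3 \<and> e\<^sub>4\<close> with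
  \<open>w x \<in> \<langle>e\<^sub>3, e\<^sub>4\<rangle>\<close> and \<open>u x \<in> V\<close>. The second compatibility condition says
  \<open>\<Delta> [x, y, z] = ad\<^bsub>y,z\<^esub> \<cdot> \<Delta> x\<close>. Writing \<open>T v\<close> as \<open>[e\<^sub>4, v, e\<^sub>3]\<close> and as \<open>[e\<^sub>3, e\<^sub>4, v]\<close> gives
  \<open>\<Delta> (T v) = 0\<close>, so \<open>\<Delta> [x, e\<^sub>3, e\<^sub>4] = 0\<close> for all \<open>x\<close>, that is \<open>tr T w x = 0\<close> and \<open>T (u x) = 0\<close>. Since
  also \<open>\<Delta> [x, v, e\<^sub>3] = 0\<close>, we get \<open>u x \<and> T v = 0\<close> for \<open>v \<in> V\<close>. Together with
  \<open>T (u x) = 0\<close> this yields \<open>tr T u x = 0\<close>.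
\<close>

section \<open>Multilinear expansions and dual bases\<close>

lemma trilinear_sum:
  assumes "trilinear f"
  shows "f (\<Sum>i\<in>I. g i) y z = (\<Sum>i\<in>I. f (g i) y z)"
    and "f x (\<Sum>i\<in>I. g i) z = (\<Sum>i\<in>I. f x (g i) z)"
    and "f x y (\<Sum>i\<in>I. g i) = (\<Sum>i\<in>I. f x y (g i))"
  using assms clinear_sum[of "\<lambda>x. f x y z"] clinear_sum[of "\<lambda>y. f x y z"]
    clinear_sum[of "\<lambda>z. f x y z"]
  by (simp_all add: trilinear_def)

lemma trilinear_scale:
  assumes "trilinear f"
  shows "f (c *\<^sub>C x) y z = c *\<^sub>C f x y z"
    and "f x (c *\<^sub>C y) z = c *\<^sub>C f x y z"
    and "f x y (c *\<^sub>C z) = c *\<^sub>C f x y z"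
  using assms by (simp_all add: trilinear_def clinear_iff)

lemma dual_eqI: "(\<And>x. dual_apply a x = dual_apply b x) \<Longrightarrow> a = b"
  by (metis dual_apply_inject ext)

lemma dual_apply_sum: "dual_apply (\<Sum>i\<in>I. g i) x = (\<Sum>i\<in>I. dual_apply (g i) x)"
  by (induction I rule: infinite_finite_induct) (simp_all add: zero_dual.rep_eq plus_dual.rep_eq)

lemma dual_basis:
  fixes B :: "'a::complex_vector set"
  assumes "finite B" "complex_vector.independent B" "complex_vector.span B = UNIV"
  obtains f :: "'a \<Rightarrow> 'a dual"
  where "\<And>b b'. b \<in> B \<Longrightarrow> b' \<in> B \<Longrightarrow> dual_apply (f b) b' = (if b' = b then 1 else 0)"
    and "\<And>x. x = (\<Sum>b\<in>B. dual_apply (f b) x *\<^sub>C b)"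
proof -
  let ?r = "\<lambda>b x. complex_vector.representation B x b"
  have "clinear (?r b)" for b
    using assms by (simp add: clinear_iff complex_vector.representation_add
        complex_vector.representation_scale scaleC_complex_def)
  then have f: "dual_apply (Abs_dual (?r b)) = ?r b" for b
    by (simp add: Abs_dual_inverse)
  show thesis
  proof
    show "dual_apply (Abs_dual (?r b)) b' = (if b' = b then 1 else 0)" if "b' \<in> B" for b b'
      using assms that by (simp add: f complex_vector.representation_basis)
    show "x = (\<Sum>b\<in>B. dual_apply (Abs_dual (?r b)) x *\<^sub>C b)" for x
      using assms by (simp add: f complex_vector.sum_representation_eq)
  qed
qed

lemma dual_expansion:
  assumes "\<And>x. x = (\<Sum>b\<in>B. dual_apply (f b) x *\<^sub>C b)"
  shows "a = (\<Sum>b\<in>B. dual_apply a b *\<^sub>C f b)"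
proof (rule dual_eqI)
  fix x
  have "dual_apply a x = dual_apply a (\<Sum>b\<in>B. dual_apply (f b) x *\<^sub>C b)"
    by (simp flip: assms)
  also have "\<dots> = dual_apply (\<Sum>b\<in>B. dual_apply a b *\<^sub>C f b) x"
    by (simp add: clinear_sum[OF clinear_dual_apply] clinear_scale[OF clinear_dual_apply]
        dual_apply_sum scaleC_dual.rep_eq scaleC_complex_def mult.commute)
  finally show "dual_apply a x = dual_apply (\<Sum>b\<in>B. dual_apply a b *\<^sub>C f b) x" .
qed

text \<open>The coordinates of a tensor are its pairings with triples of dual basis functionals, so
  it is zero once these pairings are. By linearity only pure tensors have to be expanded.\<close>

lemma tensor3_expansion:
  fixes t :: "'a::complex_vector tensor3"
  assumes exp: "\<And>x. x = (\<Sum>b\<in>B. dual_apply (f b) x *\<^sub>C b)"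
  shows "t = (\<Sum>i\<in>B. \<Sum>j\<in>B. \<Sum>k\<in>B.
    tensor3_pairing (tensor3 (f i) (f j) (f k)) t *\<^sub>C tensor3 i j k)"
proof (induction t rule: tensor3_induct)
  case (add s t)
  show ?case
    by (simp add: clinear_add[OF clinear_tensor3_pairing_right] scaleC_add_left sum.distrib
        flip: add)
next
  case (scale c s)
  show ?case
    using arg_cong[OF scale, of "scaleC c"]
    unfolding clinear_scale[OF clinear_tensor3_pairing_right]
      complex_vector.scale_sum_right scaleC_scaleC scaleC_complex_def .
next
  case (tensor x y z)
  have "tensor3 x y z = tensor3 (\<Sum>i\<in>B. dual_apply (f i) x *\<^sub>C i)
      (\<Sum>j\<in>B. dual_apply (f j) y *\<^sub>C j) (\<Sum>k\<in>B. dual_apply (f k) z *\<^sub>C k)"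
    by (simp flip: exp)
  also have "\<dots> = (\<Sum>i\<in>B. \<Sum>j\<in>B. \<Sum>k\<in>B.
      tensor3_pairing (tensor3 (f i) (f j) (f k)) (tensor3 x y z) *\<^sub>C tensor3 i j k)"
    unfolding trilinear_sum(1)[OF trilinear_tensor3]
    unfolding trilinear_sum(2)[OF trilinear_tensor3]
    unfolding trilinear_sum(3)[OF trilinear_tensor3]
    by (simp add: trilinear_scale[OF trilinear_tensor3] tensor3_pairing_tensor3 scaleC_scaleC
        mult_ac)
  finally show ?case .
qed

section \<open>Transposes and the derivation action on the tensor cube\<close>

lemma tensor3_pairing_map:
  assumes "clinear g" "clinear h" "clinear k"
    and "\<And>x. dual_apply a' x = dual_apply a (g x)"
    and "\<And>x. dual_apply b' x = dual_apply b (h x)"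
    and "\<And>x. dual_apply c' x = dual_apply c (k x)"
  shows "tensor3_pairing (tensor3 a b c) (tensor3_map g h k t) = tensor3_pairing (tensor3 a' b' c') t"
  by (induction t rule: tensor3_induct)
    (simp_all add: assms tensor3_map_tensor3 tensor3_pairing_tensor3
      clinear_add[OF clinear_tensor3_map] clinear_scale[OF clinear_tensor3_map]
      clinear_add[OF clinear_tensor3_pairing_right] clinear_scale[OF clinear_tensor3_pairing_right])

lemma trilinear_pairing: "trilinear (\<lambda>a b c. tensor3_pairing (tensor3 a b c) t)"
  using trilinear_pairing_aux[of t] by (simp add: tensor3_pairing_tensor3_left)

lemma dual_comp_exists:
  assumes "clinear g"
  shows "\<exists>a'. \<forall>x. dual_apply a' x = dual_apply a (g x)"
proof -
  have "clinear (\<lambda>x. dual_apply a (g x))"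
    using assms clinear_dual_apply[of a] by (simp add: clinear_iff)
  then show ?thesis
    by (metis Abs_dual_inverse mem_Collect_eq)
qed

text \<open>Transposition moves \<open>g\<close> onto one functional in each summand; expanding that
  functional in the dual basis produces the coefficients. This turns the compatibility condition
  into scalar equations.\<close>

lemma tensor3_pairing_derivation:
  fixes g :: "'a::complex_vector \<Rightarrow> 'a"
  assumes g: "clinear g" and exp: "\<And>x. x = (\<Sum>b\<in>B. dual_apply (f b) x *\<^sub>C b)"
  shows "tensor3_pairing (tensor3 a b c)
      (tensor3_map id id g t + tensor3_map id g id t + tensor3_map g id id t) =
    (\<Sum>l\<in>B. dual_apply c (g l) * tensor3_pairing (tensor3 a b (f l)) t
      + dual_apply b (g l) * tensor3_pairing (tensor3 a (f l) c) t
      + dual_apply a (g l) * tensor3_pairing (tensor3 (f l) b c) t)"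
proof -
  obtain a' where a': "\<And>x. dual_apply a' x = dual_apply a (g x)"
    using dual_comp_exists[OF g] by blast
  obtain b' where b': "\<And>x. dual_apply b' x = dual_apply b (g x)"
    using dual_comp_exists[OF g] by blast
  obtain c' where c': "\<And>x. dual_apply c' x = dual_apply c (g x)"
    using dual_comp_exists[OF g] by blast
  have id: "clinear id" by (simp add: clinear_iff)
  note tri = trilinear_sum[OF trilinear_pairing[of t]] trilinear_scale[OF trilinear_pairing[of t]]
  have "tensor3_pairing (tensor3 a b c)
      (tensor3_map id id g t + tensor3_map id g id t + tensor3_map g id id t)
    = tensor3_pairing (tensor3 a b c') t + tensor3_pairing (tensor3 a b' c) t
      + tensor3_pairing (tensor3 a' b c) t"
    by (simp add: clinear_add[OF clinear_tensor3_pairing_right] a' b' c' g id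
        tensor3_pairing_map[of id id g a a b b c' c]
        tensor3_pairing_map[of id g id a a b' b c c]
        tensor3_pairing_map[of g id id a' a b b c c])
  also have "tensor3_pairing (tensor3 a b c') t
      = (\<Sum>l\<in>B. dual_apply c (g l) * tensor3_pairing (tensor3 a b (f l)) t)"
    by (subst dual_expansion[OF exp, of c']) (simp add: tri c' scaleC_complex_def)
  also have "tensor3_pairing (tensor3 a b' c) t
      = (\<Sum>l\<in>B. dual_apply b (g l) * tensor3_pairing (tensor3 a (f l) c) t)"
    by (subst dual_expansion[OF exp, of b']) (simp add: tri b' scaleC_complex_def)
  also have "tensor3_pairing (tensor3 a' b c) t
      = (\<Sum>l\<in>B. dual_apply a (g l) * tensor3_pairing (tensor3 (f l) b c) t)"
    by (subst dual_expansion[OF exp, of a']) (simp add: tri a' scaleC_complex_def)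
  finally show ?thesis unfolding sum.distrib .
qed

section \<open>Skew-symmetric functions of three arguments\<close>

lemma alternating_repeat:
  fixes h :: "'i \<Rightarrow> 'i \<Rightarrow> 'i \<Rightarrow> 'v::complex_vector"
  assumes "\<And>a b c. h b a c = - h a b c" "\<And>a b c. h a c b = - h a b c"
  shows "h a a c = 0" "h a c c = 0" "h a c a = 0"
proof -
  have neg: "v = 0" if "v = - v" for v :: 'v
  proof -
    have "(2::complex) *\<^sub>C v = v + v"
      using scaleC_add_left[of 1 1 v] by (simp add: scaleC_one)
    with that show ?thesis by (metis complex_vector.scale_eq_0_iff add.left_inverse zero_neq_numeral)
  qed
  show 1: "h a a c = 0" for a c using assms(1) neg by blast
  show "h a c c = 0" using assms(2) neg by blast
  show "h a c a = 0" using assms(2)[of a c a] 1[of a c] by simp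
qed

text \<open>The two swaps generate all permutations of the arguments and repeated arguments give
  zero, so four values decide everything.\<close>

lemma alternating_eq_0:
  fixes h :: "'i \<Rightarrow> 'i \<Rightarrow> 'i \<Rightarrow> 'v::complex_vector"
  assumes swap: "\<And>a b c. h b a c = - h a b c" "\<And>a b c. h a c b = - h a b c"
    and "h p q r = 0" "h p q s = 0" "h p r s = 0" "h q r s = 0"
    and "a \<in> {p, q, r, s}" "b \<in> {p, q, r, s}" "c \<in> {p, q, r, s}"
  shows "h a b c = 0"
proof -
  have "h a' b' c' = 0 \<and> h a' c' b' = 0 \<and> h b' a' c' = 0 \<and> h b' c' a' = 0
      \<and> h c' a' b' = 0 \<and> h c' b' a' = 0" if "h a' b' c' = 0" for a' b' c'
    using that swap(1)[of a' b' c'] swap(2)[of a' b' c'] swap(2)[of b' a' c']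
      swap(1)[of a' c' b'] swap(1)[of b' c' a'] by simp
  note perms = this[OF assms(3)] this[OF assms(4)] this[OF assms(5)] this[OF assms(6)]
  show ?thesis
    using assms(7-9) by (auto simp: perms alternating_repeat[of h, OF swap])
qed

section \<open>Vanishing of the cobracket\<close>

text \<open>Common form of the three cases: \<open>p\<close>, \<open>q\<close>, \<open>r\<close>,
  \<open>s\<close> are the matrix entries of the endomorphism T, and \<open>p + s\<close> is its
  trace.\<close>

lemma double_construction_trivial_of_trace_nonzero:
  fixes br :: "'a::complex_vector \<Rightarrow> 'a \<Rightarrow> 'a \<Rightarrow> 'a"
  assumes dist: "distinct [e1, e2, e3, e4]"
    and ind: "complex_vector.independent {e1, e2, e3, e4}"
    and span: "complex_vector.span {e1, e2, e3, e4} = UNIV"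
    and br134: "br e1 e3 e4 = p *\<^sub>C e1 + q *\<^sub>C e2"
    and br234: "br e2 e3 e4 = r *\<^sub>C e1 + s *\<^sub>C e2"
    and br123: "br e1 e2 e3 = 0" and br124: "br e1 e2 e4 = 0"
    and trace: "p + s \<noteq> 0"
    and bialg: "double_construction_3lie_bialgebra br \<Delta>"
  shows "\<Delta> x = 0"
proof -
  let ?B = "{e1, e2, e3, e4}"
  have "three_lie_algebra br"
    using bialg by (simp add: double_construction_3lie_bialgebra_def)
  then have lie: "trilinear br" and swap: "br y x z = - br x y z" "br x z y = - br x y z" for x y z
    unfolding three_lie_algebra_def by blast+
  have \<Delta>: "clinear \<Delta>"
    and dual: "three_lie_algebra (\<lambda>a b c. dual_map \<Delta> (tensor3 a b c))"
    and compat: "\<Delta> (br x y z) = tensor3_map id id (br y z) (\<Delta> x)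
       + tensor3_map id (br y z) id (\<Delta> x) + tensor3_map (br y z) id id (\<Delta> x)" for x y z
    using bialg unfolding double_construction_3lie_bialgebra_def by blast+
  obtain f where f: "\<And>b b'. b \<in> ?B \<Longrightarrow> b' \<in> ?B \<Longrightarrow> dual_apply (f b) b' = (if b' = b then 1 else 0)"
    and exp: "\<And>x. x = (\<Sum>b\<in>?B. dual_apply (f b) x *\<^sub>C b)"
    using dual_basis[OF _ ind span] by auto
  \<comment> \<open>The coordinates of \<open>\<Delta> x\<close>: those at \<open>e1 e2 e3\<close>
    and \<open>e1 e2 e4\<close> describe w x, those at \<open>e1 e3 e4\<close> and
    \<open>e2 e3 e4\<close> describe u x.\<close>
  define D where "D x i j k = tensor3_pairing (tensor3 (f i) (f j) (f k)) (\<Delta> x)" for x i j k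
  have D_swap: "D x j i k = - D x i j k" "D x i k j = - D x i j k" for x i j k
  proof -
    have dual_swap: "dual_map \<Delta> (tensor3 b a c) = - dual_map \<Delta> (tensor3 a b c)"
      "dual_map \<Delta> (tensor3 a c b) = - dual_map \<Delta> (tensor3 a b c)" for a b c
      using dual unfolding three_lie_algebra_def by blast+
    show "D x j i k = - D x i j k"
      using arg_cong[OF dual_swap(1)[where a = "f i" and b = "f j" and c = "f k"],
          of "\<lambda>a. dual_apply a x"]
      by (simp only: D_def dual_apply_dual_map[OF \<Delta>] uminus_dual.rep_eq)
    show "D x i k j = - D x i j k"
      using arg_cong[OF dual_swap(2)[where a = "f i" and b = "f j" and c = "f k"],
          of "\<lambda>a. dual_apply a x"]
      by (simp only: D_def dual_apply_dual_map[OF \<Delta>] uminus_dual.rep_eq)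
  qed
  note D_repeat = alternating_repeat[of "D x" for x, OF D_swap]
  have D_eq_0: "D x i j k = 0" if "i \<in> ?B" "j \<in> ?B" "k \<in> ?B"
    "D x e1 e2 e3 = 0" "D x e1 e2 e4 = 0" "D x e1 e3 e4 = 0" "D x e2 e3 e4 = 0" for x i j k
    using alternating_eq_0[of "D x", OF D_swap] that by blast
  have D_0: "D 0 i j k = 0" for i j k
    by (simp add: D_def clinear_0[OF \<Delta>] clinear_0[OF clinear_tensor3_pairing_right])
  have D_br: "D (br x y z) i j k =
      (\<Sum>l\<in>?B. dual_apply (f k) (br y z l) * D x i j l + dual_apply (f j) (br y z l) * D x i l k
        + dual_apply (f i) (br y z l) * D x l j k)" for x y z i j k
    unfolding D_def compat
    by (rule tensor3_pairing_derivation[OF _ exp]) (use lie in \<open>simp add: trilinear_def\<close>)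

  have br_repeat: "br x x y = 0" "br x y y = 0" "br x y x = 0" for x y
    using alternating_repeat[of br, OF swap] by auto
  define T where "T v = br v e3 e4" for v
  have br_T: "br e3 e4 v = T v" "br v e3 e4 = T v" "br e4 v e3 = T v" for v
    unfolding T_def by (metis swap minus_minus)+
  have T: "T e1 = p *\<^sub>C e1 + q *\<^sub>C e2" "T e2 = r *\<^sub>C e1 + s *\<^sub>C e2" "T e3 = 0" "T e4 = 0"
    by (simp_all add: T_def br134 br234 br_repeat)
  have br0: "br e1 e3 e2 = 0" "br e2 e3 e1 = 0" "br e4 e1 e2 = 0" "br e4 e2 e1 = 0"
      "br e2 e1 e3 = 0"
    using br123 br124 by (metis swap neg_equal_0_iff_equal)+
  have f_app: "dual_apply (f i) 0 = 0" "dual_apply (f i) (c *\<^sub>C x + d *\<^sub>C y) =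
      c * dual_apply (f i) x + d * dual_apply (f i) y" for i c x d y
    by (simp_all add: clinear_0[OF clinear_dual_apply] clinear_add[OF clinear_dual_apply]
        clinear_scale[OF clinear_dual_apply] scaleC_complex_def)
  have f_T: "dual_apply (f e1) (T e1) = p" "dual_apply (f e2) (T e1) = q"
      "dual_apply (f e1) (T e2) = r" "dual_apply (f e2) (T e2) = s"
      "dual_apply (f e3) (T e1) = 0" "dual_apply (f e4) (T e1) = 0"
      "dual_apply (f e3) (T e2) = 0" "dual_apply (f e4) (T e2) = 0"
    using dist by (auto simp: T f f_app)
  \<comment> \<open>Only swaps of decreasing pairs are kept, so that rewriting sorts the indices and
    terminates.\<close>
  note sort = D_swap(1)[where j=e2 and i=e1] D_swap(1)[where j=e3 and i=e1]
    D_swap(1)[where j=e4 and i=e1] D_swap(1)[where j=e3 and i=e2]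
    D_swap(1)[where j=e4 and i=e2] D_swap(1)[where j=e4 and i=e3]
    D_swap(2)[where k=e2 and j=e1] D_swap(2)[where k=e3 and j=e1]
    D_swap(2)[where k=e4 and j=e1] D_swap(2)[where k=e3 and j=e2]
    D_swap(2)[where k=e4 and j=e2] D_swap(2)[where k=e4 and j=e3]
  have sum4: "(\<Sum>l\<in>?B. g l) = g e1 + g e2 + g e3 + g e4" for g :: "'a \<Rightarrow> complex"
    using dist by (simp add: add.assoc)
  note expand = D_br sum4 D_repeat sort f_app(1) f_T br_repeat br0 br_T T(3,4)

  \<comment> \<open>\<open>br e3 e4\<close> acts as \<open>T\<close>, which kills \<open>e3\<close>
    and \<open>e4\<close>: it scales e1 \<and> e2 by the trace and maps u y to T (u y). Dropping
    \<open>br_T(2)\<close> keeps \<open>br y e3 e4\<close> unfolded for \<open>D_br\<close>.\<close>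
  have D_T: "D (T y) e1 e2 e3 = (p + s) * D y e1 e2 e3" "D (T y) e1 e2 e4 = (p + s) * D y e1 e2 e4"
      "D (T y) e1 e3 e4 = p * D y e1 e3 e4 + r * D y e2 e3 e4"
      "D (T y) e2 e3 e4 = q * D y e1 e3 e4 + s * D y e2 e3 e4" for y
    unfolding br_T(2)[symmetric] by (simp_all add: expand algebra_simps del: br_T(2))
  \<comment> \<open>\<open>br v e3\<close> sends \<open>e4\<close> to \<open>T v\<close> and kills
    the other basis vectors, so only an e1 \<and> e2 \<and> e3 term survives; up to sign its
    coefficient is u y \<and> T v.\<close>
  have D_v3: "D (br y v e3) e1 e2 e3 = dual_apply (f e1) (T v) * D y e2 e3 e4
        - dual_apply (f e2) (T v) * D y e1 e3 e4"
      "D (br y v e3) e1 e2 e4 = 0" "D (br y v e3) e1 e3 e4 = 0" "D (br y v e3) e2 e3 e4 = 0"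
    if "v \<in> {e1, e2}" for v y
    using that by (auto simp: expand)
  \<comment> \<open>Here \<open>e3\<close> is replaced by \<open>T v\<close> instead, so no e1
    \<and> e2 \<and> e3 term can arise.\<close>
  have D_4v: "D (br y e4 v) e1 e2 e3 = 0" if "v \<in> {e1, e2}" for v y
    using that by (auto simp: expand)
  have D_T_0: "D (T v) i j k = 0" if "v \<in> ?B" "i \<in> ?B" "j \<in> ?B" "k \<in> ?B" for v i j k
  proof (cases "v \<in> {e1, e2}")
    case True
    show ?thesis
      \<comment> \<open>Writing \<open>T v\<close> as \<open>br e4 v e3\<close> removes three
        coordinates, and writing it as \<open>br e3 e4 v\<close> removes the last.\<close>
      using D_v3(2-4)[OF True, of e4] D_4v[OF True, of e3]
      unfolding br_T by (intro D_eq_0[OF that(2-4)])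
  next
    case False
    with that show ?thesis by (auto simp: T D_0)
  qed
  have basis: "D y i j k = 0" if y: "y \<in> ?B" and ijk: "i \<in> ?B" "j \<in> ?B" "k \<in> ?B" for y i j k
  proof (rule D_eq_0[OF ijk])
    have w: "(p + s) * D y e1 e2 e3 = 0" "(p + s) * D y e1 e2 e4 = 0"
      and Tu: "p * D y e1 e3 e4 + r * D y e2 e3 e4 = 0" "q * D y e1 e3 e4 + s * D y e2 e3 e4 = 0"
      using D_T_0[OF y] by (simp_all flip: D_T)
    show "D y e1 e2 e3 = 0" "D y e1 e2 e4 = 0"
      using w trace by auto
    \<comment> \<open>The bracket is \<open>T v\<close> for y = \<open>e4\<close> and 0 for the
      other basis vectors.\<close>
    have "D (br y v e3) e1 e2 e3 = 0" if "v \<in> {e1, e2}" for v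
      using y that by (auto simp: D_0 br_repeat br123 br0 br_T swap(2)[of e3 _ e3] D_T_0)
    then have "p * D y e2 e3 e4 - q * D y e1 e3 e4 = 0" "r * D y e2 e3 e4 - s * D y e1 e3 e4 = 0"
      using D_v3(1)[of e1 y] D_v3(1)[of e2 y] by (simp_all add: f_T)
    \<comment> \<open>The first equation is the first of \<open>Tu\<close> minus the second wedge
      equation; the second is the second of \<open>Tu\<close> plus the first wedge equation.\<close>
    with Tu have "(p + s) * D y e1 e3 e4 = 0" "(p + s) * D y e2 e3 e4 = 0"
      by (simp_all add: algebra_simps)
    then show "D y e1 e3 e4 = 0" "D y e2 e3 e4 = 0"
      using trace by auto
  qed
  have "\<Delta> y = 0" if "y \<in> ?B" for y
    using tensor3_expansion[OF exp, of "\<Delta> y"] basis[OF that]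
    by (simp only: D_def[symmetric] complex_vector.scale_zero_left sum.neutral_const cong: sum.cong)
  moreover have "\<Delta> x = (\<Sum>b\<in>?B. dual_apply (f b) x *\<^sub>C \<Delta> b)"
    using arg_cong[OF exp, of \<Delta> x] by (simp only: clinear_sum[OF \<Delta>] clinear_scale[OF \<Delta>])
  ultimately show ?thesis
    by (simp only: complex_vector.scale_zero_right sum.neutral_const cong: sum.cong)
qed

theorem theorem4p6:
  fixes br :: "'a::complex_vector \<Rightarrow> 'a \<Rightarrow> 'a \<Rightarrow> 'a"
    and \<Delta> :: "'a \<Rightarrow> 'a tensor3"
    and e1 e2 e3 e4 :: 'a
  assumes "three_lie_algebra br"
    and "distinct [e1, e2, e3, e4]"
    and "complex_vector.independent {e1, e2, e3, e4}"
    and "complex_vector.span {e1, e2, e3, e4} = UNIV"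
    and "(br e1 e2 e3 = e1 \<and> br e1 e2 e4 = 0 \<and> br e1 e3 e4 = 0 \<and> br e2 e3 e4 = 0) \<or>
         (br e2 e3 e4 = e2 \<and> br e1 e3 e4 = e1 \<and> br e1 e2 e3 = 0 \<and> br e1 e2 e4 = 0) \<or>
         (\<exists>\<alpha>::complex. \<alpha> \<noteq> 0 \<and>
            br e2 e3 e4 = \<alpha> *\<^sub>C e1 + e2 \<and> br e1 e3 e4 = e2 \<and>
            br e1 e2 e3 = 0 \<and> br e1 e2 e4 = 0)"
    and "double_construction_3lie_bialgebra br \<Delta>"
  shows "\<Delta> = (\<lambda>x. 0)"
proof
  fix x
  note trivial = double_construction_trivial_of_trace_nonzero[OF _ _ _ _ _ _ _ _ assms(6)]
  have swap: "br y x z = - br x y z" "br x z y = - br x y z" for x y z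
    using assms(1) unfolding three_lie_algebra_def by blast+
  from assms(5) consider
      (2) "br e1 e2 e3 = e1" "br e1 e2 e4 = 0" "br e1 e3 e4 = 0" "br e2 e3 e4 = 0"
    | (5) "br e2 e3 e4 = e2" "br e1 e3 e4 = e1" "br e1 e2 e3 = 0" "br e1 e2 e4 = 0"
    | (6) \<alpha> where "br e2 e3 e4 = \<alpha> *\<^sub>C e1 + e2" "br e1 e3 e4 = e2"
        "br e1 e2 e3 = 0" "br e1 e2 e4 = 0"
    by blast
  then show "\<Delta> x = 0"
  proof cases
    case 2
    have "br e4 e2 e3 = 0" "br e1 e4 e2 = 0" "br e1 e4 e3 = 0"
      using 2 by (metis swap neg_equal_0_iff_equal)+
    moreover have "{e1, e4, e2, e3} = {e1, e2, e3, e4}" by auto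
    \<comment> \<open>With \<open>e2\<close>, \<open>e3\<close> in the roles of the third and fourth
      vectors, T is diag(1, 0) on the span of \<open>e1\<close>, \<open>e4\<close>.\<close>
    ultimately show ?thesis
      using assms(2-4) 2 by (intro trivial[of e1 e4 e2 e3 1 0 0 0]) (auto simp: scaleC_one)
  next
    case 5
    then show ?thesis
      using assms(2-4) by (intro trivial[of e1 e2 e3 e4 1 0 0 1]) (auto simp: scaleC_one)
  next
    case 6
    then show ?thesis
      using assms(2-4) by (intro trivial[of e1 e2 e3 e4 0 1 \<alpha> 1]) (auto simp: scaleC_one)
  qed
qed

end
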